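(* Let $w$ be a Sturmian word and let $k$ be the length of the longest block of the more frequent letter in $w$. Then $$G_n(w)=\{[1,2,\ldots,n-1,n],\ [n,n-1,\ldots,2,1]\}\quad\text{for each } n>4k+2.$$
   Context: A Sturmian word is an infinite aperiodic word $w=w_1w_2\cdots$ having exactly $n+1$ distinct factors of each length $n$ (so it is binary). A block of a letter $a$ is a factor of the form $a^r$. $F_n(w)$ denotes the set of factors of length $n$ of $w$. A permutation $g\in S_n$ acts on a word $u=u_1\cdots u_n$ by $g(u)=u_{g^{-1}(1)}\cdots u_{g^{-1}(n)}$; the symmetry group of order $n$ of $w$ is $G_n(w)=\{\pi\in S_n \mid \pi(x)\in F_n(w)\text{ for each }x\in F_n(w)\}$. $[m_1,\ldots,m_n]$ denotes the permutation $i\mapsto m_i$. *)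

theory Defs
  imports Complex_Main "HOL-Combinatorics.Permutations"
begin

text \<open>An infinite word over the alphabet \<open>'a\<close> is a function \<open>nat \<Rightarrow> 'a\<close>; positions in
  infinite words, in finite words (lists) and in permutations are all numbered from 0.\<close>

definition factors :: "nat \<Rightarrow> (nat \<Rightarrow> 'a) \<Rightarrow> 'a list set" where
  "factors n w = {map w [i..<i + n] | i. True}"

text \<open>Aperiodicity is understood in the usual strong sense: not even ultimately periodic.\<close>

definition aperiodic :: "(nat \<Rightarrow> 'a) \<Rightarrow> bool" where
  "aperiodic w \<longleftrightarrow> \<not> (\<exists>p>0. \<exists>N. \<forall>i\<ge>N. w (i + p) = w i)"

definition sturmian :: "(nat \<Rightarrow> 'a) \<Rightarrow> bool" where
  "sturmian w \<longleftrightarrow> aperiodic w \<and> (\<forall>n. card (factors n w) = n + 1)"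

definition has_letter_frequency :: "(nat \<Rightarrow> 'a) \<Rightarrow> 'a \<Rightarrow> real \<Rightarrow> bool" where
  "has_letter_frequency w a x \<longleftrightarrow>
     (\<lambda>n. real (card {i. i < n \<and> w i = a}) / real n) \<longlonglongrightarrow> x"

definition most_frequent_letter :: "(nat \<Rightarrow> 'a) \<Rightarrow> 'a \<Rightarrow> bool" where
  "most_frequent_letter w a \<longleftrightarrow> a \<in> range w \<and>
     (\<exists>x. has_letter_frequency w a x \<and>
        (\<forall>b \<in> range w - {a}. \<exists>y. has_letter_frequency w b y \<and> y < x))"

definition longest_block_length :: "(nat \<Rightarrow> 'a) \<Rightarrow> 'a \<Rightarrow> nat \<Rightarrow> bool" where
  "longest_block_length w a k \<longleftrightarrow>
     replicate k a \<in> factors k w \<and> (\<forall>r. replicate r a \<in> factors r w \<longrightarrow> r \<le> k)"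

text \<open>As \<open>permute_list f xs\<close> has the entry \<open>xs ! f i\<close> at position \<open>i\<close>, the left action
  \<open>g(u) = u\<^bsub>g\<inverse>(1)\<^esub> \<dots> u\<^bsub>g\<inverse>(n)\<^esub>\<close> is \<open>permute_list (inv g) u\<close>.\<close>

definition perm_act :: "(nat \<Rightarrow> nat) \<Rightarrow> 'a list \<Rightarrow> 'a list" where
  "perm_act g u = permute_list (inv g) u"

definition symmetry_group :: "nat \<Rightarrow> (nat \<Rightarrow> 'a) \<Rightarrow> (nat \<Rightarrow> nat) set" where
  "symmetry_group n w =
     {g. g permutes {..<n} \<and> (\<forall>x \<in> factors n w. perm_act g x \<in> factors n w)}"

text \<open>The permutation given in one-line notation; following the convention of \<open>permutes\<close>,
  it is the identity outside \<open>{..<length ms}\<close>.\<close>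

definition one_line :: "nat list \<Rightarrow> nat \<Rightarrow> nat" where
  "one_line ms i = (if i < length ms then ms ! i else i)"

end

theory Submission
  imports Defs
begin

text \<open>A permutation in \<open>G\<^sub>n(w)\<close> carries the set of positions in which two factors of length
  \<open>n\<close> differ to the set in which their images, again factors, differ. Any two adjacent positions \<open>j, j + 1\<close> are realised as such a set, by
  \<open>r a b l\<close> and \<open>r b a l\<close> with \<open>r\<close> right special and \<open>l\<close> left special. Conversely, let \<open>b\<close> be
  the rarer letter. It is isolated, and the blocks of \<open>a\<close> between two letters \<open>b\<close> have length
  \<open>k - 1\<close> or \<open>k\<close>; hence for large \<open>n\<close> two factors that arise from each other by exchanging the
  letters at two positions do so at adjacent positions or at \<open>{0, n - 1}\<close>, and two factors that
  differ in one position do so at \<open>0\<close> or at \<open>n - 1\<close>. The latter shows that the permutation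
  preserves \<open>{0, n - 1}\<close>, so it is an automorphism of the path \<open>0, \<dots>, n - 1\<close>.

  The combinatorial input is that the factors of a Sturmian word form a balanced set, and that
  a factorial balanced set has at most \<open>n + 1\<close> words of each length \<open>n\<close>.\<close>

section \<open>Factorial and balanced sets of binary words\<close>

text \<open>Deleting one letter at either end suffices for closure under all infixes, and this form
  is easier to verify for an enlarged set of words.\<close>

definition factorial :: "'a list set \<Rightarrow> bool" where
  "factorial X \<longleftrightarrow> (\<forall>u\<in>X. tl u \<in> X \<and> butlast u \<in> X)"

text \<open>For binary words of equal length the counts of the two letters differ by the same
  amount, so counting \<open>b\<close> alone suffices.\<close>

definition balanced :: "'a \<Rightarrow> 'a list set \<Rightarrow> bool" where
  "balanced b X \<longleftrightarrow>
     (\<forall>u\<in>X. \<forall>v\<in>X. length u = length v \<longrightarrow> count_list u b \<le> count_list v b + 1)"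

lemma factorial_infix:
  assumes "factorial X" "x @ u @ y \<in> X"
  shows "u \<in> X"
proof -
  have "u @ y \<in> X" using assms(2)
  proof (induction x)
    case (Cons c x)
    then have "tl (c # x @ u @ y) \<in> X" using assms(1) unfolding factorial_def by force
    then show ?case using Cons.IH by simp
  qed simp
  then show "u \<in> X"
  proof (induction y rule: rev_induct)
    case (snoc c y)
    then have "butlast ((u @ y) @ [c]) \<in> X" using assms(1) unfolding factorial_def by force
    then show ?case using snoc.IH by (simp only: butlast_snoc)
  qed simp
qed

lemma card_image_Un_image:
  assumes "finite A" "finite B" "inj f" "inj g" "range f \<inter> range g = {}"
  shows "card (f ` A \<union> g ` B) = card (A \<union> B) + card (A \<inter> B)"
proof -
  have "card (f ` A \<union> g ` B) = card (f ` A) + card (g ` B)"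
    using assms by (intro card_Un_disjoint) auto
  also have "\<dots> = card A + card B"
    using assms by (simp add: card_image inj_on_subset)
  finally show ?thesis using card_Un_Int assms by metis
qed

lemma finite_binary_words: "finite {u. set u \<subseteq> {a, b} \<and> length u = n}"
  by (rule finite_lists_length_eq) simp

text \<open>Counts words by their tails: every tail counts once, and a left special one, which
  admits both letters, once more.\<close>

lemma card_words_Suc_left:
  assumes "a \<noteq> b" and X: "\<And>u. u \<in> X \<Longrightarrow> set u \<subseteq> {a, b}"
  shows "card {u \<in> X. length u = Suc n} =
    card {u. length u = n \<and> (a # u \<in> X \<or> b # u \<in> X)} +
    card {u. length u = n \<and> a # u \<in> X \<and> b # u \<in> X}"
proof -
  let ?A = "{u. length u = n \<and> a # u \<in> X}" and ?B = "{u. length u = n \<and> b # u \<in> X}"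
  have fin: "finite ?A" "finite ?B"
    by (rule finite_subset[OF _ finite_binary_words[of a b n]], use X in force)+
  have "{u \<in> X. length u = Suc n} = Cons a ` ?A \<union> Cons b ` ?B"
    using X by (fastforce simp: length_Suc_conv)
  moreover have "?A \<union> ?B = {u. length u = n \<and> (a # u \<in> X \<or> b # u \<in> X)}"
    "?A \<inter> ?B = {u. length u = n \<and> a # u \<in> X \<and> b # u \<in> X}"
    by auto
  ultimately show ?thesis
    using card_image_Un_image[OF fin, of "Cons a" "Cons b"] assms(1) by auto
qed

lemma card_words_Suc_right:
  assumes "a \<noteq> b" and X: "\<And>u. u \<in> X \<Longrightarrow> set u \<subseteq> {a, b}"
  shows "card {u \<in> X. length u = Suc n} =
    card {u. length u = n \<and> (u @ [a] \<in> X \<or> u @ [b] \<in> X)} +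
    card {u. length u = n \<and> u @ [a] \<in> X \<and> u @ [b] \<in> X}"
proof -
  let ?A = "{u. length u = n \<and> u @ [a] \<in> X}" and ?B = "{u. length u = n \<and> u @ [b] \<in> X}"
  have fin: "finite ?A" "finite ?B"
    by (rule finite_subset[OF _ finite_binary_words[of a b n]], use X in force)+
  have "{u \<in> X. length u = Suc n} = (\<lambda>u. u @ [a]) ` ?A \<union> (\<lambda>u. u @ [b]) ` ?B"
    using X by (fastforce simp: length_Suc_conv_rev)
  moreover have "?A \<union> ?B = {u. length u = n \<and> (u @ [a] \<in> X \<or> u @ [b] \<in> X)}"
    "?A \<inter> ?B = {u. length u = n \<and> u @ [a] \<in> X \<and> u @ [b] \<in> X}"
    by auto
  ultimately show ?thesis
    using card_image_Un_image[OF fin, of "\<lambda>u. u @ [a]" "\<lambda>u. u @ [b]"] assms(1)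
    by (auto simp: inj_def)
qed

lemma balancedD:
  assumes "balanced b X" "u \<in> X" "v \<in> X" "length u = length v"
  shows "count_list u b \<le> count_list v b + 1"
  using assms unfolding balanced_def by blast

text \<open>Two distinct left special words of the same length would first differ after a common
  prefix \<open>z\<close>, and then \<open>a z a\<close> and \<open>b z b\<close> violate balance.\<close>

lemma balanced_left_special_unique:
  assumes "a \<noteq> b" "factorial X" "balanced b X" and X: "\<And>u. u \<in> X \<Longrightarrow> set u \<subseteq> {a, b}"
    and "a # u \<in> X" "b # u \<in> X" "a # v \<in> X" "b # v \<in> X" "length u = length v"
  shows "u = v"
proof (rule ccontr)
  assume "u \<noteq> v"
  then obtain z x u' y v' where d: "x \<noteq> y" "u = z @ [x] @ u'" "v = z @ [y] @ v'"
    using same_length_different assms(9) by blast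
  have "set u \<subseteq> {a, b}" "set v \<subseteq> {a, b}" using X[OF assms(5)] X[OF assms(7)] by auto
  then have xy: "x = a \<and> y = b \<or> x = b \<and> y = a" using d by auto
  have in_X: "c # z @ [x] \<in> X \<and> c # z @ [y] \<in> X" if "c \<in> {a, b}" for c
    using factorial_infix[OF assms(2), of "[]" "c # z @ [x]" u']
      factorial_infix[OF assms(2), of "[]" "c # z @ [y]" v'] that assms d by auto
  have "a # z @ [a] \<in> X" "b # z @ [b] \<in> X" using in_X xy by auto
  from balancedD[OF assms(3) this(2,1)] show False using assms(1) by simp
qed

text \<open>Passing from length \<open>n\<close> to \<open>n + 1\<close> adds at most the number of
  left special words of length \<open>n\<close>, which is at most one.\<close>

lemma card_balanced_le:
  assumes "a \<noteq> b" "factorial X" "balanced b X" and X: "\<And>u. u \<in> X \<Longrightarrow> set u \<subseteq> {a, b}"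
  shows "card {u \<in> X. length u = n} \<le> n + 1"
proof (induction n)
  case 0
  have "{u \<in> X. length u = 0} \<subseteq> {[]}" by auto
  then have "card {u \<in> X. length u = 0} \<le> card {[] :: 'a list}" by (intro card_mono) auto
  then show ?case by simp
next
  case (Suc n)
  have fin: "finite {u \<in> X. length u = n}"
    by (rule finite_subset[OF _ finite_binary_words[of a b n]]) (use X in auto)
  have "card {u. length u = n \<and> (a # u \<in> X \<or> b # u \<in> X)} \<le> card {u \<in> X. length u = n}"
    using assms(2) unfolding factorial_def by (intro card_mono fin) force
  moreover have "card {u. length u = n \<and> a # u \<in> X \<and> b # u \<in> X} \<le> 1"
  proof -
    have "finite {u. length u = n \<and> a # u \<in> X \<and> b # u \<in> X}"
      by (rule finite_subset[OF _ finite_binary_words[of a b n]]) (use X in force)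
    then show ?thesis
      using balanced_left_special_unique[OF assms(1-3) X] by (auto simp: card_le_Suc0_iff_eq)
  qed
  ultimately show ?case
    using Suc card_words_Suc_left[of a b X n, OF assms(1) X] by simp
qed

text \<open>An unbalanced pair of least length has this form, because any deviation from it exposes
  a shorter unbalanced pair.\<close>

lemma unbalanced_palindrome:
  assumes "a \<noteq> b" "factorial X" "\<not> balanced b X" and X: "\<And>u. u \<in> X \<Longrightarrow> set u \<subseteq> {a, b}"
  obtains t where "rev t = t" "a # t @ [a] \<in> X" "b # t @ [b] \<in> X"
proof -
  define P where "P n \<longleftrightarrow> (\<exists>u\<in>X. \<exists>v\<in>X. length u = n \<and> length v = n \<and>
    count_list v b + 2 \<le> count_list u b)" for n
  define n where "n = (LEAST n. P n)"
  have "\<exists>n. P n" using assms(3) unfolding P_def balanced_def by force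
  then have "P n" unfolding n_def by (metis LeastI)
  then obtain u v where uv: "u \<in> X" "v \<in> X" "length u = n" "length v = n"
    "count_list v b + 2 \<le> count_list u b"
    unfolding P_def by blast
  have minimal: "count_list u b \<le> count_list v b + 1"
    if "u \<in> X" "v \<in> X" "length u = length v" "length u < n" for u v
  proof -
    have "\<not> P (length u)" using that(4) not_less_Least unfolding n_def by blast
    then show ?thesis using that(1-3) unfolding P_def by force
  qed
  have sub: "u \<in> X" if "x @ u @ y \<in> X" for x u y
    using factorial_infix[OF assms(2) that] .
  have "2 \<le> n" using uv count_le_length[of u b] by linarith
  have split: "\<exists>x z y. u = x # z @ [y]" if "2 \<le> length u" for u :: "'a list"
    using that by (cases u; cases "tl u" rule: rev_cases) auto
  obtain x u' x' where u: "u = x # u' @ [x']" using split[of u] \<open>2 \<le> n\<close> uv(3) by auto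
  obtain y v' y' where v: "v = y # v' @ [y']" using split[of v] \<open>2 \<le> n\<close> uv(4) by auto
  have len: "length u' = length v'" "n = length v' + 2" using u v uv by auto
  have letters: "x \<in> {a, b}" "x' \<in> {a, b}" "y \<in> {a, b}" "y' \<in> {a, b}"
    using X[OF uv(1)] X[OF uv(2)] u v by auto
  \<comment> \<open>Deleting the first letters here, and the last ones in \<open>2\<close>, must
    reduce the difference of the counts. This forces all four end letters and leaves equal counts
    inside.\<close>
  have 1: "count_list (u' @ [x']) b \<le> count_list (v' @ [y']) b + 1"
    using sub[of "[x]" "u' @ [x']" "[]"] sub[of "[y]" "v' @ [y']" "[]"] uv u v len
    by (intro minimal) auto
  have 2: "count_list (x # u') b \<le> count_list (y # v') b + 1"
    using sub[of "[]" "x # u'" "[x']"] sub[of "[]" "y # v'" "[y']"] uv u v len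
    by (intro minimal) auto
  have ends: "x = b" "y = a" "x' = b" "y' = a" and cnt: "count_list u' b = count_list v' b"
    using 1 2 uv(5) letters assms(1) unfolding u v by (auto split: if_splits)
  have u_in: "b # u' @ [b] \<in> X" and v_in: "a # v' @ [a] \<in> X" using uv u v ends by auto
  have letters': "set u' \<subseteq> {a, b}" "set v' \<subseteq> {a, b}" using X[OF u_in] X[OF v_in] by auto
  have "u' = v'"
  proof (rule ccontr)
    assume "u' \<noteq> v'"
    \<comment> \<open>Either the prefixes up to this first mismatch form a shorter unbalanced pair
      or, as \<open>u'\<close> and \<open>v'\<close> have equal counts, the suffixes after it
      do.\<close>
    then obtain z x u'' y v'' where d: "x \<noteq> y" "u' = z @ [x] @ u''" "v' = z @ [y] @ v''"
      using same_length_different len by blast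
    then consider "x = b" "y = a" | "x = a" "y = b" using letters' by auto
    then show False
    proof cases
      case 1
      have "b # z @ [b] \<in> X" "a # z @ [a] \<in> X"
        using sub[of "[]" "b # z @ [b]" "u'' @ [b]"] sub[of "[]" "a # z @ [a]" "v'' @ [a]"]
          u_in v_in d 1 by auto
      from minimal[OF this] show False using assms(1) d len by simp
    next
      case 2
      have "u'' @ [b] \<in> X" "v'' @ [a] \<in> X"
        using sub[of "b # z @ [a]" "u'' @ [b]" "[]"] sub[of "a # z @ [b]" "v'' @ [a]" "[]"]
          u_in v_in d 2 by auto
      from minimal[OF this] show False using assms(1) d len cnt 2 by simp
    qed
  qed
  moreover have "rev u' = u'"
  proof (rule ccontr)
    assume "rev u' \<noteq> u'"
    \<comment> \<open>Now \<open>z\<close> followed by \<open>x\<close> is a prefix of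
      \<open>u'\<close>, and \<open>rev z\<close> preceded by \<open>y\<close> is a suffix. As
      \<open>z\<close> and \<open>rev z\<close> have equal counts, the outer letters again make a
      shorter unbalanced pair.\<close>
    then obtain z x t1 y t2 where d: "x \<noteq> y" "u' = z @ [x] @ t1" "rev u' = z @ [y] @ t2"
      using same_length_different[of u' "rev u'"] by auto
    have d': "u' = rev t2 @ [y] @ rev z" using arg_cong[OF d(3), of rev] by simp
    have "x \<in> {a, b}" using letters'(1) unfolding d(2) by simp
    moreover have "y \<in> {a, b}" using letters'(1) unfolding d' by simp
    ultimately consider "x = b" "y = a" | "x = a" "y = b" using d(1) by auto
    then show False
    proof cases
      case 1
      have "b # z @ [b] \<in> X" "a # rev z @ [a] \<in> X"
        using sub[of "[]" "b # z @ [b]" "t1 @ [b]"] sub[of "a # rev t2" "a # rev z @ [a]" "[]"]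
          u_in[unfolded d(2)] v_in[folded \<open>u' = v'\<close>, unfolded d'] 1 by simp_all
      from minimal[OF this] show False using assms(1) d len by simp
    next
      case 2
      have "b # rev z @ [b] \<in> X" "a # z @ [a] \<in> X"
        using sub[of "[]" "a # z @ [a]" "t1 @ [a]"] sub[of "b # rev t2" "b # rev z @ [b]" "[]"]
          u_in[unfolded d'] v_in[folded \<open>u' = v'\<close>, unfolded d(2)] 2 by simp_all
      from minimal[OF this] show False using assms(1) d len by simp
    qed
  qed
  ultimately show thesis using that u_in v_in by blast
qed

section \<open>The language of a Sturmian word\<close>

definition language :: "(nat \<Rightarrow> 'a) \<Rightarrow> 'a list set" where
  "language w = {map w [i..<i + n] | i n. True}"

lemma map_upt_in_language: "map w [i..<i + n] \<in> language w"
  unfolding language_def by blast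

lemma languageE:
  assumes "u \<in> language w"
  obtains i n where "u = map w [i..<i + n]"
  using assms unfolding language_def by blast

lemma factors_eq_language: "factors n w = {u \<in> language w. length u = n}"
  unfolding factors_def language_def by force

lemma factorial_language: "factorial (language w)"
  unfolding factorial_def
proof
  fix u assume "u \<in> language w"
  then obtain i n where u: "u = map w [i..<i + n]" by (rule languageE)
  show "tl u \<in> language w \<and> butlast u \<in> language w"
  proof (cases n)
    case 0
    then show ?thesis using u map_upt_in_language[of w i 0] by simp
  next
    case (Suc m)
    have "tl u = map w [Suc i..<Suc i + m]" using u Suc by (simp add: upt_conv_Cons del: upt_Suc)
    moreover have "butlast u = map w [i..<i + m]" using u Suc by simp
    ultimately show ?thesis using map_upt_in_language by metis
  qed
qed

lemmas language_infix = factorial_infix[OF factorial_language]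

locale sturmian_word =
  fixes w :: "nat \<Rightarrow> 'a" and a b :: 'a
  assumes neq: "a \<noteq> b" and range: "range w = {a, b}" and sturm: "sturmian w"
begin

abbreviation L :: "'a list set" where "L \<equiv> language w"

lemma card_L: "card {u \<in> L. length u = n} = n + 1"
  using sturm unfolding sturmian_def factors_eq_language by blast

lemma letter: "w i = a \<or> w i = b"
  using range rangeI[of w i] by blast

lemma letters: "u \<in> L \<Longrightarrow> set u \<subseteq> {a, b}"
  unfolding language_def range[symmetric] by auto

lemma finite_L: "finite {u \<in> L. length u = n}"
  by (rule finite_subset[OF _ finite_binary_words[of a b n]]) (use letters in auto)

section \<open>Special factors: existence, and uniqueness on the right\<close>

lemma factor_extend: "map w [i..<i + n] @ [w (i + n)] \<in> L"
  using map_upt_in_language[of w i "Suc n"] by simp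

text \<open>Every factor extends to the right, so the excess of \<open>n + 2\<close> factors over
  \<open>n + 1\<close> counts exactly the right special ones.\<close>

lemma card_right_special: "card {u. length u = n \<and> u @ [a] \<in> L \<and> u @ [b] \<in> L} = 1"
proof -
  have "u @ [a] \<in> L \<or> u @ [b] \<in> L" if "u \<in> L" for u
  proof -
    obtain i n where "u = map w [i..<i + n]" using \<open>u \<in> L\<close> by (rule languageE)
    then show ?thesis using factor_extend[of i n] letter[of "i + n"] by auto
  qed
  moreover have "u \<in> L" if "u @ [c] \<in> L" for u c
    using language_infix[of "[]" u "[c]"] that by simp
  ultimately have "{u. length u = n \<and> (u @ [a] \<in> L \<or> u @ [b] \<in> L)} = {u \<in> L. length u = n}"
    by blast
  then show ?thesis
    using card_words_Suc_right[of a b L n, OF neq letters] card_L[of n] card_L[of "Suc n"] by simp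
qed

lemma right_special_unique:
  assumes "u @ [a] \<in> L" "u @ [b] \<in> L" "v @ [a] \<in> L" "v @ [b] \<in> L" "length u = length v"
  shows "u = v"
proof -
  obtain r where r: "{x. length x = length u \<and> x @ [a] \<in> L \<and> x @ [b] \<in> L} = {r}"
    using card_right_special[of "length u"] unfolding One_nat_def card_1_singleton_iff by blast
  have "u \<in> {x. length x = length u \<and> x @ [a] \<in> L \<and> x @ [b] \<in> L}"
    "v \<in> {x. length x = length u \<and> x @ [a] \<in> L \<and> x @ [b] \<in> L}" using assms by simp_all
  then have "u \<in> {r}" "v \<in> {r}" unfolding r .
  then show ?thesis by simp
qed

lemma right_special_ex:
  obtains r where "length r = n" "r @ [a] \<in> L" "r @ [b] \<in> L"
proof -
  obtain r where "{x. length x = n \<and> x @ [a] \<in> L \<and> x @ [b] \<in> L} = {r}"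
    using card_right_special[of n] unfolding One_nat_def card_1_singleton_iff by blast
  then have "r \<in> {x. length x = n \<and> x @ [a] \<in> L \<and> x @ [b] \<in> L}" by simp
  then show thesis using that by blast
qed

text \<open>So far a factor might occur only as a prefix of \<open>w\<close> and have no left
  extension, so the count gives an inequality and hence only existence.\<close>

lemma left_special_ex:
  obtains l where "length l = n" "a # l \<in> L" "b # l \<in> L"
proof -
  have "u \<in> L" if "c # u \<in> L" for u c
    using language_infix[of "[c]" u "[]"] that by simp
  then have "card {u. length u = n \<and> (a # u \<in> L \<or> b # u \<in> L)} \<le> card {u \<in> L. length u = n}"
    by (intro card_mono finite_L) auto
  then have "card {u. length u = n \<and> a # u \<in> L \<and> b # u \<in> L} \<ge> 1"
    using card_words_Suc_left[of a b L n, OF neq letters] card_L[of n] card_L[of "Suc n"] by simp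
  then have "{u. length u = n \<and> a # u \<in> L \<and> b # u \<in> L} \<noteq> {}"
    by (intro notI) simp
  then show thesis using that by blast
qed

text \<open>A factor that is not right special determines the next letter, so a repetition reached
  without passing a right special factor repeats forever.\<close>

lemma repetition_passes_right_special:
  assumes "p < q" "map w [p..<p + m] = map w [q..<q + m]" "m > 0"
  shows "\<exists>i\<in>{p..<q}. map w [i..<i + m] @ [a] \<in> L \<and> map w [i..<i + m] @ [b] \<in> L"
proof (rule ccontr)
  assume contra: "\<not> ?thesis"
  define f where "f i = map w [i..<i + m]" for i
  have not_special: "\<not> (f i @ [a] \<in> L \<and> f i @ [b] \<in> L)" if "i \<in> {p..<q}" for i
    using that contra unfolding f_def by blast
  have f_Suc: "f (Suc i) = tl (f i @ [w (i + m)])" for i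
  proof -
    have "f i @ [w (i + m)] = map w [i..<Suc (i + m)]" unfolding f_def by simp
    also have "[i..<Suc (i + m)] = i # [Suc i..<Suc i + m]" by (subst upt_conv_Cons) simp_all
    finally show ?thesis unfolding f_def by simp
  qed
  have f_extend: "f i @ [w (i + m)] \<in> L" for i
    unfolding f_def by (rule factor_extend)
  \<comment> \<open>The second conjunct keeps every later window among those starting in
    \<open>{p..<q}\<close>, none of which is right special, so the next letter stays
    determined.\<close>
  have "f (p + i) = f (q + i) \<and> (\<exists>j\<in>{p..<q}. f (p + i) = f j)" for i
  proof (induction i rule: less_induct)
    case (less i)
    have "f (p + i) = f (q + i)"
    proof (cases i)
      case 0
      then show ?thesis using assms(2) by (simp add: f_def)
    next
      case (Suc i')
      then have "i' < i" by simp
      from less.IH[OF this] have IH: "f (p + i') = f (q + i')" "\<exists>j\<in>{p..<q}. f (p + i') = f j"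
        by blast+
      then obtain j where "j \<in> {p..<q}" "f (p + i') = f j" by blast
      then have "\<not> (f (p + i') @ [a] \<in> L \<and> f (p + i') @ [b] \<in> L)"
        using not_special[of j] by simp
      then have "w (p + i' + m) = w (q + i' + m)"
        using f_extend[of "p + i'"] f_extend[of "q + i'"] IH(1)
          letter[of "p + i' + m"] letter[of "q + i' + m"] by (elim disjE) simp_all
      then show ?thesis using f_Suc[of "p + i'"] f_Suc[of "q + i'"] IH(1) Suc by simp
    qed
    moreover have "\<exists>j\<in>{p..<q}. f (p + i) = f j"
    proof (cases "p + i < q")
      case True
      then show ?thesis by (intro bexI[of _ "p + i"]) auto
    next
      case False
      then have i': "p + i = q + (p + i - q)" by simp
      then have "p + i - q < i" using assms(1) by linarith
      from less.IH[OF this] obtain j where "j \<in> {p..<q}"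
        "f (p + (p + i - q)) = f j" "f (p + (p + i - q)) = f (q + (p + i - q))" by blast
      then show ?thesis using i' by (intro bexI[of _ j]) simp_all
    qed
    ultimately show ?case by blast
  qed
  then have per: "f (p + i) = f (q + i)" for i by blast
  have "w (i + (q - p)) = w i" if "i \<ge> p" for i
  proof -
    define j where "j = i - p"
    then have j: "i = p + j" using that by simp
    have "hd (f (p + j)) = w (p + j)" "hd (f (q + j)) = w (q + j)"
      unfolding f_def using assms(3) by (simp_all add: hd_map)
    then show ?thesis using per[of j] j assms(1) by (simp add: add.commute)
  qed
  moreover have "q - p > 0" using assms(1) by simp
  ultimately show False using sturm unfolding sturmian_def aperiodic_def by blast
qed

text \<open>No occurrence of \<open>c t\<close> starts inside a given occurrence of \<open>d t d\<close>: since \<open>t\<close> is a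
  palindrome, position \<open>p\<close> and its mirror image would carry different letters. So after
  \<open>d t d\<close> there is a run of \<open>n + 2\<close> factors of length \<open>n + 1\<close> avoiding the right special
  one, \<open>c t\<close>, and two of them coincide.\<close>

lemma no_palindromic_imbalance:
  assumes "c \<noteq> d" "c \<in> {a, b}" "rev t = t" "d # t @ [d] \<in> L"
    and special: "c # t @ [a] \<in> L" "c # t @ [b] \<in> L"
  shows False
proof -
  define n where "n = length t"
  define f where "f i = map w [i..<i + Suc n]" for i
  obtain i0 m where i0: "d # t @ [d] = map w [i0..<i0 + m]"
    using assms(4) by (rule languageE)
  from arg_cong[OF this, of length] have "m = n + 2" by (simp add: n_def)
  then have w_nth: "w (i0 + j) = (d # t @ [d]) ! j" if "j < n + 2" for j
    unfolding i0 using that by (simp del: upt_Suc)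
  have first: "w i0 = d" and last: "w (i0 + Suc n) = d"
    using w_nth[of 0] w_nth[of "Suc n"] by (auto simp: n_def nth_append)
  have mid: "w (i0 + Suc j) = t ! j" if "j < n" for j
    using w_nth[of "Suc j"] that by (auto simp: n_def nth_append)
  have avoid: "f i \<noteq> c # t" if i: "i \<in> {i0..i0 + Suc n}" for i
  proof
    assume fi: "f i = c # t"
    have f_nth: "w (i + j) = (c # t) ! j" if "j < Suc n" for j
      using arg_cong[OF fi, of "\<lambda>u. u ! j"] that unfolding f_def by (simp del: upt_Suc)
    have wi: "w i = c" using f_nth[of 0] by simp
    \<comment> \<open>\<open>p\<close> is the offset inside \<open>d t d\<close>; the two end
      offsets carry \<open>d\<close>, whereas \<open>c t\<close> begins with
      \<open>c\<close>.\<close>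
    obtain p where p: "i = i0 + p" "p \<le> Suc n" using that[of "i - i0"] i by auto
    have "p \<noteq> 0" "p \<noteq> Suc n" using p wi first last assms(1) by (metis add_0_right)+
    then obtain q where q: "p = Suc q" "q < n" using p by (cases p) auto
    have "t ! q = c" using mid[OF q(2)] wi p q by simp
    \<comment> \<open>The final \<open>d\<close> of \<open>d t d\<close> is read here as a letter of
      the overlapping \<open>c t\<close>; its index mirrors \<open>q\<close>.\<close>
    moreover have "t ! (n - Suc q) = d"
      using f_nth[of "Suc (n - Suc q)"] last p q by simp
    moreover have "t ! (n - Suc q) = t ! q"
      using rev_nth[of q t] q assms(3) by (simp add: n_def)
    ultimately show False using assms(1) by simp
  qed
  have special_unique: "u = c # t" if "length u = Suc n" "u @ [a] \<in> L" "u @ [b] \<in> L" for u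
    using right_special_unique[of u "c # t"] that special by (simp add: n_def)
  have "c # t \<in> L" using language_infix[of "[]" "c # t" "[a]"] special by simp
  then have "card ({u \<in> L. length u = Suc n} - {c # t}) = n + 1"
    using card_L[of "Suc n"] finite_L by (simp add: n_def)
  moreover have "f ` {i0..i0 + Suc n} \<subseteq> {u \<in> L. length u = Suc n} - {c # t}"
    using avoid map_upt_in_language[of w _ "Suc n"] unfolding f_def by auto
  ultimately have "card (f ` {i0..i0 + Suc n}) \<le> n + 1"
    using card_mono[of "{u \<in> L. length u = Suc n} - {c # t}"] finite_L by fastforce
  then have "\<not> inj_on f {i0..i0 + Suc n}"
    by (intro pigeonhole) simp
  then obtain p q where pq: "p \<in> {i0..i0 + Suc n}" "q \<in> {i0..i0 + Suc n}" "p < q" "f p = f q"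
    unfolding inj_on_def by (metis linorder_neqE_nat)
  obtain i where "i \<in> {p..<q}" "f i @ [a] \<in> L" "f i @ [b] \<in> L"
    using repetition_passes_right_special[OF pq(3), of "Suc n"] pq(4) unfolding f_def by blast
  moreover from this have "f i = c # t" by (intro special_unique) (simp_all add: f_def del: upt_Suc)
  ultimately show False using avoid[of i] pq by auto
qed

text \<open>Imbalance makes the palindrome \<open>t\<close> right special, so by uniqueness the
  right special word one letter longer is \<open>c t\<close> for some \<open>c\<close>. For either
  value of \<open>c\<close>, the word \<open>d t d\<close> with the other letter \<open>d\<close> is
  a factor, which is impossible.\<close>

lemma balanced_L: "balanced b L"
proof (rule ccontr)
  assume "\<not> balanced b L"
  then obtain t where t: "rev t = t" "a # t @ [a] \<in> L" "b # t @ [b] \<in> L"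
    using unbalanced_palindrome[OF neq factorial_language _ letters] by blast
  obtain r where r: "length r = Suc (length t)" "r @ [a] \<in> L" "r @ [b] \<in> L"
    by (rule right_special_ex)
  then obtain c t' where ct: "r = c # t'" "length t' = length t" by (cases r) auto
  have "t' = t"
    using right_special_unique[of t' t] ct r t language_infix[of "[a]" "t @ [a]" "[]"]
      language_infix[of "[b]" "t @ [b]" "[]"] language_infix[of "[c]" "t' @ [a]" "[]"]
      language_infix[of "[c]" "t' @ [b]" "[]"] by simp
  then have special: "c # t @ [a] \<in> L" "c # t @ [b] \<in> L" using r ct by auto
  moreover have "c \<in> {a, b}" using letters[OF special(1)] by simp
  ultimately show False
    using no_palindromic_imbalance[of a b t] no_palindromic_imbalance[of b a t] neq t by auto
qed

text \<open>This shows that words are factors of \<open>w\<close> without locating them in \<open>w\<close>: it suffices that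
  adding them keeps the language factorial and balanced.\<close>

lemma L_maximal:
  assumes "factorial X" "balanced b X" "L \<subseteq> X" and X: "\<And>u. u \<in> X \<Longrightarrow> set u \<subseteq> {a, b}"
  shows "X = L"
proof
  show "X \<subseteq> L"
  proof
    fix x assume "x \<in> X"
    have "finite {u \<in> X. length u = length x}"
      by (rule finite_subset[OF _ finite_binary_words[of a b "length x"]]) (use X in auto)
    then have "{u \<in> L. length u = length x} = {u \<in> X. length u = length x}"
      using card_balanced_le[OF neq assms(1,2) X] card_L assms(3)
      by (intro card_seteq) auto
    then show "x \<in> L" using \<open>x \<in> X\<close> by blast
  qed
qed (fact assms(3))

text \<open>Reversal preserves length and letter counts, so adjoining all reversed factors keeps the
  language balanced.\<close>

lemma rev_in_L:
  assumes "u \<in> L"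
  shows "rev u \<in> L"
proof -
  have "L \<union> rev ` L = L"
  proof (rule L_maximal)
    have "tl (rev u) = rev (butlast u)" for u :: "'a list"
      by (metis butlast_rev rev_rev_ident)
    then show "factorial (L \<union> rev ` L)"
      using factorial_language[of w] unfolding factorial_def by (auto simp: butlast_rev)
    show "balanced b (L \<union> rev ` L)"
      using balanced_L unfolding balanced_def by auto
    show "set u \<subseteq> {a, b}" if "u \<in> L \<union> rev ` L" for u
      using that letters[of u] letters[of "rev u"] by auto
  qed simp
  then show ?thesis using assms by blast
qed

text \<open>The counts in \<open>r b\<close> and \<open>r a\<close> are consecutive integers, so
  balance leaves other factors of that length only these two values.\<close>

lemma count_right_special:
  assumes "r @ [a] \<in> L" "r @ [b] \<in> L" "u \<in> L" "length u = Suc (length r)"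
  shows "count_list u b \<in> {count_list r b, Suc (count_list r b)}"
  using balancedD[OF balanced_L assms(3,1)] balancedD[OF balanced_L assms(2,3)] assms(4) neq by auto

lemma count_left_special:
  assumes "a # l \<in> L" "b # l \<in> L" "u \<in> L" "length u = Suc (length l)"
  shows "count_list u b \<in> {count_list l b, Suc (count_list l b)}"
  using balancedD[OF balanced_L assms(3,1)] balancedD[OF balanced_L assms(2,3)] assms(4) neq by auto

text \<open>All words of this shape may be adjoined to the language. Deleting an end letter shortens
  \<open>r\<close> or \<open>l\<close>, which stay special, or, if that part is empty, leaves a
  factor.\<close>

lemma right_special_swap_left_special:
  assumes "r @ [a] \<in> L" "r @ [b] \<in> L" "a # l \<in> L" "b # l \<in> L" "{x, y} = {a, b}"
  shows "r @ [x, y] @ l \<in> L"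
proof -
  define S where "S = {r @ [x, y] @ l | r x y l. r @ [a] \<in> L \<and> r @ [b] \<in> L \<and>
    a # l \<in> L \<and> b # l \<in> L \<and> {x, y} = {a, b}}"
  have tl_r: "tl r @ [c] \<in> L" if "r @ [c] \<in> L" "r \<noteq> []" for r c
    using language_infix[of "[hd r]" "tl r @ [c]" "[]"] that by (cases r) auto
  have butlast_l: "c # butlast l \<in> L" if "c # l \<in> L" "l \<noteq> []" for l c
    using language_infix[of "[]" "c # butlast l" "[last l]"] that by simp
  have S_count: "count_list z b \<in> {c, Suc c}"
    if z: "z \<in> S" and l: "a # l \<in> L" "b # l \<in> L" "length z = Suc (length l)"
      and c: "c = count_list l b" for z l c
  proof -
    obtain r x y l' where z: "z = r @ [x, y] @ l'" "r @ [a] \<in> L" "r @ [b] \<in> L"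
      "a # l' \<in> L" "b # l' \<in> L" "{x, y} = {a, b}" using z unfolding S_def by blast
    \<comment> \<open>Each factor of the length of \<open>z\<close> is cut after
      \<open>length r + 1\<close> letters, and each piece has one of two possible counts. The count
      of \<open>z\<close> is the middle of the resulting range, which must contain the counts of
      both \<open>a # l\<close> and \<open>b # l\<close>.\<close>
    have bounds: "count_list u b \<in>
        {count_list r b + count_list l' b..count_list r b + count_list l' b + 2}"
      if u: "u \<in> L" "length u = length z" for u
    proof -
      let ?u1 = "take (Suc (length r)) u" and ?u2 = "drop (Suc (length r)) u"
      have "?u1 \<in> L" "?u2 \<in> L"
        using language_infix[of "[]" ?u1 ?u2] language_infix[of ?u1 ?u2 "[]"] u by simp_all
      then have "count_list ?u1 b \<in> {count_list r b, Suc (count_list r b)}"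
        "count_list ?u2 b \<in> {count_list l' b, Suc (count_list l' b)}"
        using count_right_special[OF z(2,3)] count_left_special[OF z(4,5)] u z(1) by auto
      moreover have "count_list u b = count_list ?u1 b + count_list ?u2 b"
        by (metis append_take_drop_id count_list_append)
      ultimately show ?thesis by auto
    qed
    have "count_list z b = count_list r b + count_list l' b + 1"
      using z(1,6) neq by (auto simp: doubleton_eq_iff)
    then show ?thesis using bounds[OF l(1)] bounds[OF l(2)] l(3) c neq by auto
  qed
  have "L \<union> S = L"
  proof (rule L_maximal)
    have "tl z \<in> L \<union> S" if "z \<in> S" for z
    proof -
      obtain r x y l where z: "z = r @ [x, y] @ l" "r @ [a] \<in> L" "r @ [b] \<in> L"
        "a # l \<in> L" "b # l \<in> L" "{x, y} = {a, b}" using \<open>z \<in> S\<close> unfolding S_def by blast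
      show ?thesis
      proof (cases "r = []")
        case True
        then show ?thesis using z by (auto simp: doubleton_eq_iff)
      next
        case False
        then have "tl z = tl r @ [x, y] @ l" using z by simp
        then show ?thesis using z tl_r[OF _ False] unfolding S_def by blast
      qed
    qed
    moreover have "butlast z \<in> L \<union> S" if "z \<in> S" for z
    proof -
      obtain r x y l where z: "z = r @ [x, y] @ l" "r @ [a] \<in> L" "r @ [b] \<in> L"
        "a # l \<in> L" "b # l \<in> L" "{x, y} = {a, b}" using \<open>z \<in> S\<close> unfolding S_def by blast
      show ?thesis
      proof (cases "l = []")
        case True
        then show ?thesis using z by (auto simp: doubleton_eq_iff butlast_append)
      next
        case False
        then have "butlast z = r @ [x, y] @ butlast l" using z by (simp add: butlast_append)
        then show ?thesis using z butlast_l[OF _ False] unfolding S_def by blast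
      qed
    qed
    ultimately show "factorial (L \<union> S)"
      using factorial_language[of w] unfolding factorial_def by blast
    show "balanced b (L \<union> S)"
      unfolding balanced_def
    proof (intro ballI impI)
      fix u v assume uv: "u \<in> L \<union> S" "v \<in> L \<union> S" "length u = length v"
      show "count_list u b \<le> count_list v b + 1"
      proof (cases "length u")
        case 0
        then show ?thesis by simp
      next
        case (Suc m)
        obtain l where l: "length l = m" "a # l \<in> L" "b # l \<in> L" by (rule left_special_ex)
        then have "count_list z b \<in> {count_list l b, Suc (count_list l b)}"
          if "z \<in> L \<union> S" "length z = Suc m" for z
          using that count_left_special[OF l(2,3)] S_count[OF _ l(2,3)] by blast
        from this[of u] this[of v] show ?thesis using uv Suc by auto
      qed
    qed
    show "set u \<subseteq> {a, b}" if "u \<in> L \<union> S" for u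
      using that letters unfolding S_def by force
  qed simp
  then show ?thesis using assms unfolding S_def by blast
qed

end

section \<open>Block lengths\<close>

lemma binary_word_cases:
  assumes "set u \<subseteq> {a, b}"
  obtains m where "u = replicate m a" | m v where "u = replicate m a @ b # v"
proof (cases "b \<in> set u")
  case True
  then obtain x v where x: "u = x @ b # v" "b \<notin> set x" using split_list_first by metis
  then have "\<forall>c\<in>set x. c = a" using assms by auto
  then show thesis using that(2)[of "length x" v] x(1) replicate_length_same[of x a] by metis
next
  case False
  then have "\<forall>c\<in>set u. c = a" using assms by auto
  then show thesis using that(1)[of "length u"] replicate_length_same[of u a] by metis
qed

lemma binary_word_cases_rev:
  assumes "set u \<subseteq> {a, b}"
  obtains m where "u = replicate m a" | m v where "u = v @ b # replicate m a"
proof -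
  have "set (rev u) \<subseteq> {a, b}" using assms by simp
  then show thesis
  proof (cases rule: binary_word_cases)
    case (1 m)
    then have "u = replicate m a" by (metis rev_replicate rev_rev_ident)
    then show thesis by (rule that(1))
  next
    case (2 m v)
    then have "u = rev (replicate m a @ b # v)" by (metis rev_rev_ident)
    then have "u = rev v @ b # replicate m a" by simp
    then show thesis by (rule that(2))
  qed
qed

lemma replicate_merge: "replicate i a @ a # replicate m a @ z = replicate (Suc (i + m)) a @ z"
  by (induction i) simp_all

text \<open>Of the letter frequencies only \<open>no_bb\<close> is retained: the rarer letter
  \<open>b\<close> is isolated.\<close>

locale sturmian_blocks = sturmian_word +
  fixes k :: nat
  assumes no_bb: "[b, b] \<notin> language w"
    and block: "replicate k a \<in> language w"
    and block_le: "replicate r a \<in> language w \<Longrightarrow> r \<le> k"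
begin

lemma replicate_le:
  assumes "x @ replicate r a @ y \<in> L"
  shows "r \<le> k"
  using language_infix[OF assms] by (rule block_le)

lemma no_bb_infix: "x @ b # b # y \<notin> L"
  using language_infix[of x "[b, b]" y] no_bb by auto

text \<open>Otherwise \<open>m + 2\<close> consecutive letters \<open>a\<close> would occur, and
  this word without \<open>b\<close> would contradict balance with \<open>b a^m b\<close>, of the
  same length.\<close>

lemma gap_ge:
  assumes "x @ b # replicate m a @ b # y \<in> L"
  shows "k \<le> Suc m"
proof (rule ccontr)
  assume "\<not> k \<le> Suc m"
  then have "k = (m + 2) + (k - (m + 2))" by simp
  then have "replicate k a = [] @ replicate (m + 2) a @ replicate (k - (m + 2)) a"
    by (metis append_Nil replicate_add)
  then have "replicate (m + 2) a \<in> L" using block language_infix by metis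
  moreover have "b # replicate m a @ [b] \<in> L"
    using language_infix[of x "b # replicate m a @ [b]" y] assms by simp
  moreover have "count_list (replicate j a) b = 0" for j using neq by (induction j) auto
  ultimately show False
    using balancedD[OF balanced_L, of "b # replicate m a @ [b]" "replicate (m + 2) a"]
    by (simp del: replicate_Suc)
qed

text \<open>A block bounded by \<open>b\<close> on both sides in one word has length at least
  \<open>k - 1\<close>, while the other word extends it by two or more letters \<open>a\<close>,
  beyond \<open>k\<close>. The length bound handles the case in which \<open>s\<close>,
  \<open>t\<close> and \<open>r\<close> contain no \<open>b\<close>.\<close>

lemma swap_left_empty:
  assumes u: "s @ a # t @ b # r \<in> L" and v: "s @ b # t @ a # r \<in> L"
    and "t \<noteq> []" and len: "2 * k \<le> length s + length t + length r"
  shows "s = []"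
proof (rule ccontr)
  assume "s \<noteq> []"
  have sets: "set s \<subseteq> {a, b}" "set t \<subseteq> {a, b}" "set r \<subseteq> {a, b}"
    using letters[OF u] by auto
  show False
  proof (cases rule: binary_word_cases_rev[OF sets(1)])
    case (2 i s0)
    have "k \<le> Suc i" using gap_ge[of s0 i "t @ a # r"] v 2 by simp
    obtain c t' where t: "t = c # t'" using \<open>t \<noteq> []\<close> by (cases t) auto
    have "c \<noteq> b" using no_bb_infix[of s "t' @ a # r"] v t by auto
    then have "c = a" using sets t by auto
    then have "Suc (Suc i) \<le> k"
      using replicate_le[of "s0 @ [b]" "Suc (Suc i)" "t' @ b # r"] u t 2
      by (simp add: replicate_app_Cons_same)
    then show False using \<open>k \<le> Suc i\<close> by simp
  next
    case s: (1 i)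
    then have "i > 0" using \<open>s \<noteq> []\<close> by (cases i) auto
    show False
    proof (cases rule: binary_word_cases[OF sets(2)])
      case (2 m t0)
      have "k \<le> Suc m" using gap_ge[of s m "t0 @ a # r"] v 2 by simp
      moreover have "Suc (i + m) \<le> k"
        using replicate_le[of "[]" "Suc (i + m)" "b # t0 @ b # r"] u s 2
          replicate_merge[of i a m "b # t0 @ b # r"] by simp
      ultimately show False using \<open>i > 0\<close> by simp
    next
      case t: (1 m)
      then have "m > 0" using \<open>t \<noteq> []\<close> by (cases m) auto
      have im: "Suc (i + m) \<le> k"
        using replicate_le[of "[]" "Suc (i + m)" "b # r"] u s t
          replicate_merge[of i a m "b # r"] by simp
      show False
      proof (cases rule: binary_word_cases[OF sets(3)])
        case (1 c)
        have "Suc (m + c) \<le> k"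
          using replicate_le[of "s @ [b]" "Suc (m + c)" "[]"] v t 1
            replicate_merge[of m a c "[]"] by simp
        then show False using len im s t 1 by simp
      next
        case (2 c r0)
        have "Suc (m + c) \<le> k"
          using replicate_le[of "s @ [b]" "Suc (m + c)" "b # r0"] v t 2
            replicate_merge[of m a c "b # r0"] by simp
        moreover have "k \<le> Suc c" using gap_ge[of "s @ a # t" c r0] u 2 by simp
        ultimately show False using \<open>m > 0\<close> by simp
      qed
    qed
  qed
qed

text \<open>Closure under reversal turns the statement about the left end into one about both
  ends.\<close>

lemma swap_nonadjacent:
  assumes u: "s @ x # t @ y # r \<in> L" and v: "s @ y # t @ x # r \<in> L"
    and "x \<noteq> y" "t \<noteq> []" and len: "2 * k \<le> length s + length t + length r"
  shows "s = [] \<and> r = []"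
proof -
  have *: "s = [] \<and> r = []"
    if u: "s @ a # t @ b # r \<in> L" and v: "s @ b # t @ a # r \<in> L"
      and len: "2 * k \<le> length s + length t + length r" for s r
  proof -
    have "rev r @ a # rev t @ b # rev s \<in> L" "rev r @ b # rev t @ a # rev s \<in> L"
      using rev_in_L[OF u] rev_in_L[OF v] by simp_all
    then show ?thesis
      using swap_left_empty[OF u v] swap_left_empty[of "rev r" "rev t" "rev s"] assms(4) len
      by (simp add: ac_simps)
  qed
  have "x \<in> {a, b}" "y \<in> {a, b}" using letters[OF u] by auto
  then show ?thesis using *[of s r] u v len \<open>x \<noteq> y\<close> by auto
qed

text \<open>With letters on both sides, the block through the changed \<open>a\<close> would consist
  of that letter, a block of length at least \<open>k - 1\<close>, and a further \<open>a\<close>.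
  If there is no \<open>b\<close> around, the length bound gives the contradiction.\<close>

lemma single_change_at_end:
  assumes u: "s @ x # t \<in> L" and v: "s @ y # t \<in> L" and "x \<noteq> y"
    and len: "k \<le> length s + length t"
  shows "s = [] \<or> t = []"
proof (rule ccontr)
  assume ne: "\<not> ?thesis"
  have sets: "set s \<subseteq> {a, b}" "set t \<subseteq> {a, b}" "x \<in> {a, b}" "y \<in> {a, b}"
    using letters[OF u] letters[OF v] by auto
  then have u: "s @ a # t \<in> L" and v: "s @ b # t \<in> L" using u v \<open>x \<noteq> y\<close> by auto
  obtain c t' where t: "t = c # t'" using ne by (cases t) auto
  have "c \<noteq> b" using no_bb_infix[of s t'] v t by auto
  then have "c = a" using sets t by auto
  show False
  proof (cases rule: binary_word_cases_rev[OF sets(1)])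
    case (2 i s0)
    have "k \<le> Suc i" using gap_ge[of s0 i t] v 2 by simp
    moreover have "Suc (Suc i) \<le> k"
      using replicate_le[of "s0 @ [b]" "Suc (Suc i)" t'] u t 2 \<open>c = a\<close>
      by (simp add: replicate_app_Cons_same)
    ultimately show False by simp
  next
    case s: (1 i)
    then have "i > 0" using ne by (cases i) auto
    show False
    proof (cases rule: binary_word_cases[OF sets(2)])
      case (1 m)
      have "Suc (i + m) \<le> k"
        using replicate_le[of "[]" "Suc (i + m)" "[]"] u s 1 replicate_merge[of i a m "[]"] by simp
      then show False using len s 1 by simp
    next
      case (2 m t0)
      have "k \<le> Suc m" using gap_ge[of s m t0] v 2 by simp
      moreover have "Suc (i + m) \<le> k"
        using replicate_le[of "[]" "Suc (i + m)" "b # t0"] u s 2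
          replicate_merge[of i a m "b # t0"] by simp
      ultimately show False using \<open>i > 0\<close> by simp
    qed
  qed
qed

end

section \<open>Symmetries as automorphisms of the path of positions\<close>

lemma nth_perm_act:
  assumes "g permutes {..<n}" "length u = n" "j < n"
  shows "perm_act g u ! j = u ! inv g j"
  unfolding perm_act_def using permute_list_nth[of "inv g" u j] permutes_inv[OF assms(1)] assms by simp

lemma one_line_upt: "one_line [0..<n] = id"
  unfolding one_line_def by auto

lemma one_line_rev_upt: "one_line (rev [0..<n]) i = (if i < n then n - 1 - i else i)"
  unfolding one_line_def by (simp add: rev_nth)

lemma list_split_two_nth:
  assumes "p < q" "q < length u"
  shows "u = take p u @ u ! p # take (q - Suc p) (drop (Suc p) u) @ u ! q # drop (Suc q) u"
proof -
  have "drop (Suc p) u = take (q - Suc p) (drop (Suc p) u) @ drop (Suc p) u ! (q - Suc p) #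
      drop (Suc (q - Suc p)) (drop (Suc p) u)"
    by (rule id_take_nth_drop) (use assms in simp)
  also have "drop (Suc p) u ! (q - Suc p) = u ! q" using assms by simp
  also have "drop (Suc (q - Suc p)) (drop (Suc p) u) = drop (Suc q) u" using assms by simp
  finally show ?thesis using id_take_nth_drop[of p u] assms by simp
qed

context sturmian_blocks
begin

lemma swap_positions:
  assumes "u \<in> L" "v \<in> L" "length u = n" "length v = n" "p < q" "q < n"
    and diff: "\<And>i. i < n \<Longrightarrow> u ! i \<noteq> v ! i \<longleftrightarrow> i = p \<or> i = q"
    and swap: "u ! p = v ! q" "u ! q = v ! p"
    and n: "2 * k + 2 \<le> n"
  shows "q = Suc p \<or> p = 0 \<and> q = n - 1"
proof (rule ccontr)
  assume contra: "\<not> ?thesis"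
  have same: "v ! i = u ! i" if "i < n" "i \<noteq> p" "i \<noteq> q" for i
    using diff[OF that(1)] that by simp
  let ?t = "take (q - Suc p) (drop (Suc p) u)"
  have parts: "take p v = take p u" "drop (Suc q) v = drop (Suc q) u"
    "take (q - Suc p) (drop (Suc p) v) = ?t"
    using assms(3-6) same by (auto intro!: nth_equalityI)
  have "take p u @ u ! p # ?t @ u ! q # drop (Suc q) u \<in> L"
    using list_split_two_nth[of p q u] assms by simp
  moreover have "take p u @ u ! q # ?t @ u ! p # drop (Suc q) u \<in> L"
    using list_split_two_nth[of p q v] parts assms by simp
  moreover have "u ! p \<noteq> u ! q" using diff[of p] swap assms(5,6) by simp
  moreover have "?t \<noteq> []" using contra assms by auto
  moreover have "2 * k \<le> length (take p u) + length ?t + length (drop (Suc q) u)"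
    using assms by simp
  ultimately have "take p u = [] \<and> drop (Suc q) u = []" by (rule swap_nonadjacent)
  then show False using contra assms by auto
qed

lemma single_position:
  assumes "u \<in> L" "v \<in> L" "length u = n" "length v = n" "p < n"
    and diff: "\<And>i. i < n \<Longrightarrow> u ! i \<noteq> v ! i \<longleftrightarrow> i = p"
    and n: "k < n"
  shows "p = 0 \<or> p = n - 1"
proof -
  have same: "v ! i = u ! i" if "i < n" "i \<noteq> p" for i
    using diff[OF that(1)] that by simp
  have parts: "take p v = take p u" "drop (Suc p) v = drop (Suc p) u"
    using assms(3-5) same by (auto intro!: nth_equalityI)
  have "take p u @ u ! p # drop (Suc p) u \<in> L" "take p u @ v ! p # drop (Suc p) u \<in> L"
    using id_take_nth_drop[of p u] id_take_nth_drop[of p v] parts assms by simp_all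
  moreover have "u ! p \<noteq> v ! p" using diff[of p] assms(5) by simp
  moreover have "k \<le> length (take p u) + length (drop (Suc p) u)" using assms by simp
  ultimately have "take p u = [] \<or> drop (Suc p) u = []" by (rule single_change_at_end)
  then show ?thesis using assms by auto
qed

lemma symmetry_in_L:
  assumes "g \<in> symmetry_group n w" "u \<in> L" "length u = n"
  shows "perm_act g u \<in> L" "length (perm_act g u) = n"
  using assms unfolding symmetry_group_def factors_eq_language by (auto simp: perm_act_def)

text \<open>Prefixing a left special word, or extending a right special one, by either letter gives
  two factors that differ only at \<open>p\<close>; their images differ only at
  \<open>g p\<close>.\<close>

lemma symmetry_ends:
  assumes g: "g \<in> symmetry_group n w" and n: "k < n" and p: "p = 0 \<or> p = n - 1"
  shows "g p = 0 \<or> g p = n - 1"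
proof -
  have perm: "g permutes {..<n}" using g unfolding symmetry_group_def by simp
  have "p < n" using p n by auto
  obtain m where m: "n = Suc m" using n by (cases n) auto
  obtain u v where uv: "u \<in> L" "v \<in> L" "length u = n" "length v = n"
    "\<And>i. i < n \<Longrightarrow> u ! i \<noteq> v ! i \<longleftrightarrow> i = p"
  proof (cases "p = 0")
    case True
    obtain l where "length l = m" "a # l \<in> L" "b # l \<in> L" by (rule left_special_ex)
    then show thesis using that[of "a # l" "b # l"] m True neq by (auto simp: nth_Cons')
  next
    case False
    obtain r where "length r = m" "r @ [a] \<in> L" "r @ [b] \<in> L" by (rule right_special_ex)
    then show thesis using that[of "r @ [a]" "r @ [b]"] m False p neq by (auto simp: nth_append)
  qed
  have inv: "inv g i < n \<longleftrightarrow> i < n" "inv g i = p \<longleftrightarrow> i = g p" for i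
    using permutes_in_image[OF permutes_inv[OF perm], of i] permutes_inv_eq[OF perm, of i p] by auto
  show ?thesis
  proof (rule single_position[OF symmetry_in_L(1)[OF g uv(1,3)] symmetry_in_L(1)[OF g uv(2,4)]
        symmetry_in_L(2)[OF g uv(1,3)] symmetry_in_L(2)[OF g uv(2,4)] _ _ n])
    show "g p < n" using permutes_in_image[OF perm, of p] \<open>p < n\<close> by simp
    show "perm_act g u ! i \<noteq> perm_act g v ! i \<longleftrightarrow> i = g p" if "i < n" for i
      using nth_perm_act[OF perm uv(3) that] nth_perm_act[OF perm uv(4) that] uv(5)[of "inv g i"]
        inv that by simp
  qed
qed

text \<open>The images of \<open>r a b l\<close> and \<open>r b a l\<close> differ by exchanging the
  letters at \<open>g j\<close> and \<open>g (Suc j)\<close>, so these positions are adjacent or the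
  two ends.\<close>

lemma symmetry_adjacent:
  assumes g: "g \<in> symmetry_group n w" and n: "2 * k + 2 < n" and j: "Suc j < n"
  shows "g (Suc j) = Suc (g j) \<or> g j = Suc (g (Suc j))"
proof -
  have perm: "g permutes {..<n}" using g unfolding symmetry_group_def by simp
  then have inj: "g x = g y \<longleftrightarrow> x = y" for x y by (metis permutes_inj injD)
  define m where "m = n - Suc (Suc j)"
  then have m: "n = Suc (Suc (j + m))" using j by simp
  obtain r where r: "length r = j" "r @ [a] \<in> L" "r @ [b] \<in> L" by (rule right_special_ex)
  obtain l where l: "length l = m" "a # l \<in> L" "b # l \<in> L" by (rule left_special_ex)
  define u where "u = r @ [a, b] @ l"
  define v where "v = r @ [b, a] @ l"
  have uv: "u \<in> L" "v \<in> L" "length u = n" "length v = n"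
    unfolding u_def v_def using right_special_swap_left_special r l m by auto
  have diff: "u ! i \<noteq> v ! i \<longleftrightarrow> i = j \<or> i = Suc j" if "i < n" for i
    unfolding u_def v_def using r l neq by (auto simp: nth_append nth_Cons')
  have swap: "u ! j = v ! Suc j" "u ! Suc j = v ! j"
    unfolding u_def v_def using r by (auto simp: nth_append)
  have inv: "inv g i < n \<longleftrightarrow> i < n" "inv g i = p \<longleftrightarrow> i = g p" "inv g (g p) = p" for i p
    using permutes_in_image[OF permutes_inv[OF perm], of i] permutes_inv_eq[OF perm, of i p]
      permutes_inverses[OF perm] by auto
  have g_less: "g i < n \<longleftrightarrow> i < n" for i using permutes_in_image[OF perm, of i] by simp
  note act = nth_perm_act[OF perm uv(3)] nth_perm_act[OF perm uv(4)]
  have gdiff: "perm_act g u ! i \<noteq> perm_act g v ! i \<longleftrightarrow> i = g j \<or> i = g (Suc j)" if "i < n" for i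
    using act[OF that] diff[of "inv g i"] inv that by simp
  have gswap: "perm_act g u ! g j = perm_act g v ! g (Suc j)"
    "perm_act g u ! g (Suc j) = perm_act g v ! g j"
    using act swap inv(3) g_less j by simp_all
  have words: "perm_act g u \<in> L" "perm_act g v \<in> L" "length (perm_act g u) = n"
    "length (perm_act g v) = n" using symmetry_in_L[OF g] uv by auto
  have not_ends: "\<not> ({g j, g (Suc j)} = {0, n - 1})"
  proof
    assume ends: "{g j, g (Suc j)} = {0, n - 1}"
    \<comment> \<open>Since \<open>g\<close> maps ends to ends and is injective, \<open>j\<close>
      and \<open>Suc j\<close> would themselves be the two ends, although
      \<open>n > 2\<close>.\<close>
    have "g 0 \<in> {0, n - 1}" "g (n - 1) \<in> {0, n - 1}"
      using symmetry_ends[OF g, of 0] symmetry_ends[OF g, of "n - 1"] n by auto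
    then have "0 \<in> {j, Suc j}" "n - 1 \<in> {j, Suc j}" unfolding ends[symmetric] using inj by auto
    then show False using n by auto
  qed
  have "g j \<noteq> g (Suc j)" using inj by simp
  then consider "g j < g (Suc j)" | "g (Suc j) < g j" by linarith
  then show ?thesis
  proof cases
    case 1
    have "g (Suc j) = Suc (g j) \<or> g j = 0 \<and> g (Suc j) = n - 1"
      by (rule swap_positions[OF words 1]) (use g_less j gdiff gswap n in auto)
    then show ?thesis using not_ends by auto
  next
    case 2
    have "g j = Suc (g (Suc j)) \<or> g (Suc j) = 0 \<and> g j = n - 1"
      by (rule swap_positions[OF words 2]) (use g_less j gdiff gswap n in auto)
    then show ?thesis using not_ends by auto
  qed
qed

text \<open>\<open>g\<close> starts at an end and moves by one position at a time; injectivity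
  forbids turning back.\<close>

lemma symmetry_cases:
  assumes g: "g \<in> symmetry_group n w" and n: "2 * k + 2 < n"
  shows "g = one_line [0..<n] \<or> g = one_line (rev [0..<n])"
proof -
  have perm: "g permutes {..<n}" using g unfolding symmetry_group_def by simp
  then have inj: "g x = g y \<longleftrightarrow> x = y" for x y by (metis permutes_inj injD)
  have g_less: "g i < n \<longleftrightarrow> i < n" for i using permutes_in_image[OF perm, of i] by simp
  have outside: "g i = i" if "\<not> i < n" for i using permutes_not_in[OF perm] that by simp
  have adj: "g (Suc j) = Suc (g j) \<or> g j = Suc (g (Suc j))" if "Suc j < n" for j
    using symmetry_adjacent[OF g n that] .
  have "g 0 = 0 \<or> g 0 = n - 1" using symmetry_ends[OF g, of 0] n by simp
  then show ?thesis
  proof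
    assume g0: "g 0 = 0"
    have "i < n \<longrightarrow> g i = i" for i
    proof (induction i rule: less_induct)
      case (less i)
      show ?case
      proof (cases i)
        case (Suc j)
        show ?thesis
        proof
          assume "i < n"
          have "g j = j" using less[of j] Suc \<open>i < n\<close> by simp
          \<comment> \<open>For \<open>j = 0\<close> the truncated \<open>j - 1\<close> is
            \<open>0\<close>, and injectivity still applies since \<open>g 0 = 0\<close>.\<close>
          moreover have "g i \<noteq> j - 1"
          proof
            assume "g i = j - 1"
            moreover have "g (j - 1) = j - 1" using less[of "j - 1"] Suc \<open>i < n\<close> by simp
            ultimately have "i = j - 1" using inj by metis
            then show False using Suc by simp
          qed
          ultimately show "g i = i" using adj[of j] Suc \<open>i < n\<close> by auto
        qed
      qed (use g0 in simp)
    qed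
    then have "g = id" using outside by (metis eq_id_iff)
    then show ?thesis by (simp add: one_line_upt)
  next
    assume g0: "g 0 = n - 1"
    have "i < n \<longrightarrow> g i = n - 1 - i" for i
    proof (induction i rule: less_induct)
      case (less i)
      show ?case
      proof (cases i)
        case (Suc j)
        show ?thesis
        proof
          assume "i < n"
          have gj: "g j = n - 1 - j" using less[of j] Suc \<open>i < n\<close> by simp
          have "g i < n" using g_less \<open>i < n\<close> by simp
          have "g i \<noteq> Suc (g j)"
          proof
            assume gi: "g i = Suc (g j)"
            then have "j \<noteq> 0" using gj \<open>g i < n\<close> by auto
            then have "g (j - 1) = Suc (n - 1 - j)" using less[of "j - 1"] Suc \<open>i < n\<close> by simp
            then have "i = j - 1" using inj gi gj by metis
            then show False using Suc by simp
          qed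
          then show "g i = n - 1 - i" using adj[of j] gj Suc \<open>i < n\<close> by auto
        qed
      qed (use g0 in simp)
    qed
    then have "g = one_line (rev [0..<n])" using outside by (intro ext) (simp add: one_line_rev_upt)
    then show ?thesis by simp
  qed
qed

lemma id_in_symmetry_group: "one_line [0..<n] \<in> symmetry_group n w"
  unfolding symmetry_group_def one_line_upt by (simp add: permutes_id perm_act_def)

text \<open>The permutation is an involution, so the inverse in \<open>perm_act\<close> leaves it
  unchanged and it acts as \<open>rev\<close>.\<close>

lemma reversal_in_symmetry_group: "one_line (rev [0..<n]) \<in> symmetry_group n w"
proof -
  let ?g = "one_line (rev [0..<n])"
  have invol: "?g (?g i) = i" for i by (simp add: one_line_rev_upt)
  have "\<exists>!x. ?g x = y" for y by (rule ex1I[of _ "?g y"]) (use invol in metis)+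
  then have perm: "?g permutes {..<n}"
    unfolding permutes_def by (simp add: one_line_rev_upt)
  have inv: "inv ?g = ?g" using invol by (intro inv_equality) auto
  have "perm_act ?g u = rev u" if "length u = n" for u :: "'a list"
    using that nth_perm_act[OF perm that] inv
    by (intro nth_equalityI) (auto simp: perm_act_def[of _ u] one_line_rev_upt rev_nth)
  then show ?thesis
    using perm rev_in_L unfolding symmetry_group_def factors_eq_language by auto
qed

end

section \<open>From the hypotheses on \<open>w\<close> to the two locales\<close>

lemma sturmian_range:
  assumes "sturmian w" "a \<in> range w"
  obtains b where "a \<noteq> b" "range w = {a, b}"
proof -
  have "factors 1 w = (\<lambda>c. [c]) ` range w" unfolding factors_def by auto
  then have "card ((\<lambda>c. [c]) ` range w) = 2" using assms(1) unfolding sturmian_def by (metis one_add_one)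
  then have "card (range w) = 2" by (simp add: card_image inj_on_def)
  then obtain x y where "range w = {x, y}" "x \<noteq> y" by (auto simp: card_2_iff)
  then show thesis using assms(2) that[of x] that[of y] by auto
qed

text \<open>If \<open>b b\<close> occurs then by balance \<open>a a\<close> does not, so each \<open>a\<close> is followed by a \<open>b\<close> of its
  own and \<open>a\<close> cannot be the more frequent letter.\<close>

lemma (in sturmian_word) most_frequent_no_square:
  assumes "most_frequent_letter w a"
  shows "[b, b] \<notin> L"
proof
  assume "[b, b] \<in> L"
  then have "[a, a] \<notin> L" using balancedD[OF balanced_L, of "[b, b]" "[a, a]"] neq by auto
  then have next_b: "w (Suc i) = b" if "w i = a" for i
    using factor_extend[of i 1] letter[of "Suc i"] that by auto
  have card_le: "card {i. i < n \<and> w i = a} \<le> card {i. i < n \<and> w i = b} + 1" for n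
  proof -
    have "card {i. i < n \<and> w i = a} = card (Suc ` {i. i < n \<and> w i = a})" by (simp add: card_image)
    \<comment> \<open>The extra element \<open>n\<close> accounts for an \<open>a\<close> at
      position \<open>n - 1\<close>, whose successor lies outside the range.\<close>
    also have "\<dots> \<le> card (insert n {i. i < n \<and> w i = b})"
      by (intro card_mono) (use next_b in auto)
    also have "\<dots> \<le> card {i. i < n \<and> w i = b} + 1" by (simp add: card_insert_if)
    finally show ?thesis .
  qed
  have "b \<in> range w - {a}" using range neq by auto
  then obtain x y where x: "has_letter_frequency w a x" and y: "has_letter_frequency w b y" "y < x"
    using assms unfolding most_frequent_letter_def by blast
  have "(\<lambda>n. real (card {i. i < n \<and> w i = b}) / real n + 1 / real n) \<longlonglongrightarrow> y + 0"
    using y(1) unfolding has_letter_frequency_def by (intro tendsto_add lim_1_over_n)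
  moreover have "real (card {i. i < n \<and> w i = a}) / real n
      \<le> real (card {i. i < n \<and> w i = b}) / real n + 1 / real n" for n
  proof -
    have "real (card {i. i < n \<and> w i = a}) \<le> real (card {i. i < n \<and> w i = b}) + 1"
      using card_le[of n] by linarith
    then have "real (card {i. i < n \<and> w i = a}) / real n
      \<le> (real (card {i. i < n \<and> w i = b}) + 1) / real n" by (rule divide_right_mono) simp
    then show ?thesis by (simp add: add_divide_distrib)
  qed
  ultimately have "x \<le> y + 0"
    using x unfolding has_letter_frequency_def by (intro LIMSEQ_le) auto
  then show False using y(2) by simp
qed

theorem corollary3:
  fixes w :: "nat \<Rightarrow> 'a" and a :: 'a and k n :: nat
  assumes "sturmian w"
    and "most_frequent_letter w a"
    and "longest_block_length w a k"
    and "n > 4 * k + 2"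
  shows "symmetry_group n w = {one_line [0..<n], one_line (rev [0..<n])}"
proof -
  have "a \<in> range w" using assms(2) unfolding most_frequent_letter_def by blast
  then obtain b where b: "a \<noteq> b" "range w = {a, b}" using sturmian_range[OF assms(1)] by blast
  interpret sturmian_word w a b using b assms(1) by unfold_locales
  interpret sturmian_blocks w a b k
  proof
    show "[b, b] \<notin> language w" using most_frequent_no_square[OF assms(2)] .
    show "replicate k a \<in> language w"
      using assms(3) unfolding longest_block_length_def factors_eq_language by simp
    show "r \<le> k" if "replicate r a \<in> language w" for r
      using assms(3) that unfolding longest_block_length_def factors_eq_language by simp
  qed
  show ?thesis
    using symmetry_cases[of _ n] assms(4) id_in_symmetry_group[of n] reversal_in_symmetry_group[of n]
    by auto
qed

end
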